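(* For every $p$ with $1\le p\le\infty$, the metric space $(\mathrm{Dgm}_p,w_p)$ of persistence diagrams with the $p$-Wasserstein distance does not admit an isometric embedding into a Hilbert space.
   Context: Let $\mathbb{R}^2_< = \{(x,y)\in\mathbb{R}^2 : x<y\}$ with metric $d_\infty(a,b)=\|a-b\|_\infty=\max(|a_x-b_x|,|a_y-b_y|)$, and let $\Delta$ be the diagonal in $\mathbb{R}^2$; for $a\in\mathbb{R}^2_<$, $d_\infty(a,\Delta)=\inf_{t\in\Delta}\|a-t\|_\infty=(a_y-a_x)/2$. A persistence diagram is a function $D:I\to\mathbb{R}^2_<$ with $I$ a countable (possibly finite or empty) set; $\emptyset$ denotes the diagram with empty index set. A partial matching between $D_1:I_1\to\mathbb{R}^2_<$ and $D_2:I_2\to\mathbb{R}^2_<$ is a triple $(I_1',I_2',f)$ with $I_1'\subseteq I_1$, $I_2'\subseteq I_2$ and $f:I_1'\to I_2'$ a bijection. Its $p$-cost in $[0,\infty]$ is, for $p<\infty$, $$\mathrm{cost}_p(f)=\Big(\sum_{i\in I_1'}d_\infty(D_1(i),D_2(f(i)))^p+\sum_{i\in I_1\setminus I_1'}d_\infty(D_1(i),\Delta)^p+\sum_{i\in I_2\setminus I_2'}d_\infty(D_2(i),\Delta)^p\Big)^{1/p},$$ and for $p=\infty$, $$\mathrm{cost}_\infty(f)=\max\Big\{\sup_{i\in I_1'}d_\infty(D_1(i),D_2(f(i))),\ \sup_{i\in I_1\setminus I_1'}d_\infty(D_1(i),\Delta),\ \sup_{i\in I_2\setminus I_2'}d_\infty(D_2(i),\Delta)\Big\}$$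 (suprema over empty sets are $0$). Put $\tilde w_p(D_1,D_2)=\inf\{\mathrm{cost}_p(f)\}$ over all partial matchings between $D_1$ and $D_2$. The space $(\mathrm{Dgm}_p,w_p)$ is the set of persistence diagrams $D$ with $\tilde w_p(D,\emptyset)<\infty$, modulo the relation $D_1\sim D_2$ iff $\tilde w_p(D_1,D_2)=0$, with the induced metric $w_p$. An isometric embedding of $(X,d)$ into a Hilbert space $\mathcal{H}$ is a map $\varphi:X\to\mathcal{H}$ with $d(x,y)=\|\varphi(x)-\varphi(y)\|_{\mathcal{H}}$ for all $x,y\in X$. *)

theory Defs
  imports "HOL-Analysis.Analysis"
begin

definition R2_less :: "(real \<times> real) set" where
  "R2_less = {(x, y). x < y}"

definition d_inf :: "real \<times> real \<Rightarrow> real \<times> real \<Rightarrow> real" where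
  "d_inf a b = max \<bar>fst a - fst b\<bar> \<bar>snd a - snd b\<bar>"

definition diagonal :: "(real \<times> real) set" where
  "diagonal = {(t, t) | t. True}"

definition d_diag :: "real \<times> real \<Rightarrow> real" where
  "d_diag a = (INF t\<in>diagonal. d_inf a t)"

lemma d_diag_eq:
  assumes "a \<in> R2_less"
  shows "d_diag a = (snd a - fst a) / 2"
  unfolding d_diag_def
proof (rule cInf_eq_minimum)
  define c where "c = (fst a + snd a) / 2"
  have "fst a < snd a"
    using assms by (cases a) (simp add: R2_less_def)
  then have "\<bar>fst a - c\<bar> = (snd a - fst a) / 2" "\<bar>snd a - c\<bar> = (snd a - fst a) / 2"
    unfolding c_def by (simp_all add: abs_if field_simps)
  then have "d_inf a (c, c) = (snd a - fst a) / 2"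
    by (simp add: d_inf_def)
  moreover have "(c, c) \<in> diagonal"
    by (simp add: diagonal_def)
  ultimately show "(snd a - fst a) / 2 \<in> d_inf a ` diagonal"
    by (metis imageI)
next
  fix r assume "r \<in> d_inf a ` diagonal"
  then obtain t where "r = max \<bar>fst a - t\<bar> \<bar>snd a - t\<bar>"
    by (auto simp: diagonal_def d_inf_def)
  then have "t - fst a \<le> r" "snd a - t \<le> r"
    by auto
  then show "(snd a - fst a) / 2 \<le> r"
    by (simp add: field_simps)
qed

text \<open>A persistence diagram \<open>D : I \<rightarrow> R2_less\<close> is a partial map whose domain is the index set \<open>I\<close>;
  the empty diagram is \<^term>\<open>Map.empty\<close>.\<close>

definition persistence_diagram :: "('i \<rightharpoonup> real \<times> real) \<Rightarrow> bool" where
  "persistence_diagram D \<longleftrightarrow> countable (dom D) \<and> ran D \<subseteq> R2_less"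

definition partial_matching ::
  "('i \<rightharpoonup> real \<times> real) \<Rightarrow> ('j \<rightharpoonup> real \<times> real) \<Rightarrow> 'i set \<Rightarrow> 'j set \<Rightarrow> ('i \<Rightarrow> 'j) \<Rightarrow> bool" where
  "partial_matching D1 D2 A B f \<longleftrightarrow> A \<subseteq> dom D1 \<and> B \<subseteq> dom D2 \<and> bij_betw f A B"

text \<open>Real powers on \<open>[0, \<infinity>]\<close>, meant for positive exponents only.\<close>

definition enn_powr :: "ennreal \<Rightarrow> real \<Rightarrow> ennreal" where
  "enn_powr x r = (if x = \<infinity> then \<infinity> else ennreal (enn2real x powr r))"

definition matching_cost ::
  "ennreal \<Rightarrow> ('i \<rightharpoonup> real \<times> real) \<Rightarrow> ('j \<rightharpoonup> real \<times> real) \<Rightarrow> 'i set \<Rightarrow> 'j set \<Rightarrow> ('i \<Rightarrow> 'j) \<Rightarrow> ennreal" where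
  "matching_cost p D1 D2 A B f =
    (if p = \<infinity> then
       max (SUP i\<in>A. ennreal (d_inf (the (D1 i)) (the (D2 (f i)))))
         (max (SUP i\<in>dom D1 - A. ennreal (d_diag (the (D1 i))))
              (SUP j\<in>dom D2 - B. ennreal (d_diag (the (D2 j)))))
     else
       enn_powr
         ((\<Sum>\<^sub>\<infinity>i\<in>A. ennreal (d_inf (the (D1 i)) (the (D2 (f i))) powr enn2real p))
          + (\<Sum>\<^sub>\<infinity>i\<in>dom D1 - A. ennreal (d_diag (the (D1 i)) powr enn2real p))
          + (\<Sum>\<^sub>\<infinity>j\<in>dom D2 - B. ennreal (d_diag (the (D2 j)) powr enn2real p)))
         (1 / enn2real p))"

definition w_tilde :: "ennreal \<Rightarrow> ('i \<rightharpoonup> real \<times> real) \<Rightarrow> ('j \<rightharpoonup> real \<times> real) \<Rightarrow> ennreal" where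
  "w_tilde p D1 D2 = Inf {matching_cost p D1 D2 A B f | A B f. partial_matching D1 D2 A B f}"

text \<open>Index sets are taken inside \<^typ>\<open>nat\<close>. As diagrams are only considered up to
  \<open>w_tilde p D E = 0\<close>, no diagram with a countable index set of another type is lost.\<close>

lemma reindex_nat:
  fixes D :: "'i \<rightharpoonup> real \<times> real"
  assumes "persistence_diagram D"
  shows "\<exists>E :: nat \<rightharpoonup> real \<times> real. persistence_diagram E \<and> (\<forall>p. w_tilde p D E = 0)"
proof -
  define g where "g = to_nat_on (dom D)"
  have inj: "inj_on g (dom D)"
    using assms by (auto simp: persistence_diagram_def g_def)
  define E where "E = (\<lambda>n. if n \<in> g ` dom D then D (inv_into (dom D) g n) else None)"
  have E_g: "E (g i) = D i" if "i \<in> dom D" for i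
    using that inj unfolding E_def by simp
  have dom_E: "dom E = g ` dom D"
  proof (intro set_eqI iffI)
    fix n assume "n \<in> dom E"
    then show "n \<in> g ` dom D" by (auto simp: E_def split: if_splits)
  next
    fix n assume "n \<in> g ` dom D"
    then obtain i where "i \<in> dom D" "n = g i" by blast
    then show "n \<in> dom E" using E_g[of i] by (simp add: domIff)
  qed
  have "ran E \<subseteq> ran D"
    unfolding E_def ran_def by (smt (verit, best) Collect_mono option.distinct(1))
  then have E: "persistence_diagram E"
    using assms by (auto simp: persistence_diagram_def)
  have m: "partial_matching D E (dom D) (dom E) g"
    using inj by (auto simp: partial_matching_def dom_E bij_betw_def)
  have zero: "d_inf (the (D i)) (the (E (g i))) = 0" if "i \<in> dom D" for i
    using E_g[OF that] by (simp add: d_inf_def)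
  have "matching_cost p D E (dom D) (dom E) g = 0" for p
  proof -
    have "(SUP i\<in>dom D. ennreal (d_inf (the (D i)) (the (E (g i))))) = 0"
      by (intro antisym SUP_least) (simp_all add: zero)
    moreover have "(\<Sum>\<^sub>\<infinity>i\<in>dom D. ennreal (d_inf (the (D i)) (the (E (g i))) powr enn2real p)) = 0"
      by (rule infsum_0) (simp add: zero)
    ultimately show ?thesis
      by (simp add: matching_cost_def enn_powr_def bot_ennreal)
  qed
  then have "w_tilde p D E \<le> 0" for p
    unfolding w_tilde_def using m by (intro Inf_lower CollectI exI conjI) (simp_all only:)
  then show ?thesis using E by auto
qed

definition finite_diagrams :: "ennreal \<Rightarrow> (nat \<rightharpoonup> real \<times> real) set" where
  "finite_diagrams p =
    {D. persistence_diagram D \<and> w_tilde p D (Map.empty :: nat \<rightharpoonup> real \<times> real) < \<infinity>}"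

definition dgm_rel :: "ennreal \<Rightarrow> (nat \<rightharpoonup> real \<times> real) rel" where
  "dgm_rel p =
    {(D, E). D \<in> finite_diagrams p \<and> E \<in> finite_diagrams p \<and> w_tilde p D E = 0}"

definition Dgm :: "ennreal \<Rightarrow> (nat \<rightharpoonup> real \<times> real) set set" where
  "Dgm p = finite_diagrams p // dgm_rel p"

text \<open>For \<open>1 \<le> p\<close>, \<^term>\<open>w_tilde p\<close> is a finite pseudometric on \<^term>\<open>finite_diagrams p\<close>, so the
  choice of representatives does not matter.\<close>

definition wasserstein :: "ennreal \<Rightarrow> (nat \<rightharpoonup> real \<times> real) set \<Rightarrow> (nat \<rightharpoonup> real \<times> real) set \<Rightarrow> real" where
  "wasserstein p X Y = enn2real (w_tilde p (SOME D. D \<in> X) (SOME E. E \<in> Y))"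

definition isometric_embedding ::
  "'a set \<Rightarrow> ('a \<Rightarrow> 'a \<Rightarrow> real) \<Rightarrow> ('a \<Rightarrow> 'h :: {real_inner, complete_space}) \<Rightarrow> bool" where
  "isometric_embedding X d \<phi> \<longleftrightarrow> (\<forall>x\<in>X. \<forall>y\<in>X. d x y = norm (\<phi> x - \<phi> y))"

end

theory Submission
  imports Defs
begin

text \<open>Midpoints in a Hilbert space are unique, whereas the plane with the metric \<^const>\<open>d_inf\<close>
  has pairs of points with several midpoints. Sufficiently far from the diagonal this plane embeds
  isometrically into the space of diagrams, by one-point diagrams, for every \<open>p\<close> at once: leaving
  both points unmatched costs at least the distance of one of them to the diagonal.\<close>

section \<open>Midpoints in inner product spaces\<close>

lemma Hilbert_midpoint_unique:
  fixes x y m :: "'a :: real_inner"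
  assumes "norm (x - m) = norm (x - y) / 2" and "norm (m - y) = norm (x - y) / 2"
  shows "m = (1 / 2) *\<^sub>R (x + y)"
proof -
  \<comment> \<open>The parallelogram law for \<open>x - m\<close> and \<open>m - y\<close>. Their
    sum is \<open>x - y\<close>, whose squared norm already exhausts the right-hand side, so their
    difference \<open>x + y - 2 *\<^sub>R m\<close> vanishes.\<close>
  have "(norm ((x - m) + (m - y)))\<^sup>2 + (norm ((x - m) - (m - y)))\<^sup>2
      = 2 * (norm (x - m))\<^sup>2 + 2 * (norm (m - y))\<^sup>2"
    by (simp add: power2_norm_eq_inner inner_add inner_diff inner_commute)
  then have "(norm ((x - m) - (m - y)))\<^sup>2 = 0"
    using assms by (simp add: power_divide)
  then have "x + y = 2 *\<^sub>R m"
    by (simp add: algebra_simps scaleR_2)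
  then show ?thesis
    by simp
qed

section \<open>Single terms as lower bounds for the cost of a matching\<close>

lemma d_inf_nonneg: "0 \<le> d_inf a b"
  by (simp add: d_inf_def)

lemma d_inf_eq_0D: "d_inf a b = 0 \<Longrightarrow> a = b"
  by (auto simp: d_inf_def prod_eq_iff max_def split: if_splits)

lemma d_diag_pos: "a \<in> R2_less \<Longrightarrow> 0 < d_diag a"
  using d_diag_eq[of a] by (auto simp: R2_less_def)

text \<open>Passes from one summand of a p-th power sum to the p-th root of the sum: taking r-th
  roots is monotone, and an infinite \<open>S\<close> has an infinite root.\<close>

lemma le_enn_powr_inverse:
  assumes "1 \<le> r" "0 \<le> x" "ennreal (x powr r) \<le> S"
  shows "ennreal x \<le> enn_powr S (1 / r)"
proof (cases "S = \<infinity>")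
  case False
  then have "x powr r \<le> enn2real S"
    using assms(3) by (metis enn2real_ennreal enn2real_mono infinity_ennreal_def powr_ge_zero
        top.not_eq_extremum)
  then have "(x powr r) powr (1 / r) \<le> enn2real S powr (1 / r)"
    using assms(1) by (intro powr_mono2) auto
  then show ?thesis
    using assms False by (simp add: enn_powr_def powr_powr ennreal_leI)
qed (simp add: enn_powr_def)

lemma member_le_infsum_ennreal:
  fixes g :: "'a \<Rightarrow> ennreal"
  assumes "i \<in> A"
  shows "g i \<le> infsum g A"
proof -
  have "infsum g {i} \<le> infsum g A"
    using assms by (intro infsum_mono_neutral nonneg_summable_on_complete) auto
  then show ?thesis
    by simp
qed

lemma enn2real_ge_1: "1 \<le> p \<Longrightarrow> p \<noteq> \<infinity> \<Longrightarrow> 1 \<le> enn2real p"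
  by (metis enn2real_1 enn2real_mono infinity_ennreal_def top.not_eq_extremum)

text \<open>A term never exceeds the supremum, nor a summand the sum of nonnegative terms. This and
  its two analogues for unmatched points give bounds free of \<open>p\<close>, so that later
  arguments treat finite and infinite \<open>p\<close> alike.\<close>

lemma matched_le_matching_cost:
  assumes "1 \<le> p" "i \<in> A"
  shows "ennreal (d_inf (the (D1 i)) (the (D2 (f i)))) \<le> matching_cost p D1 D2 A B f"
proof (cases "p = \<infinity>")
  case True
  then show ?thesis
    using assms(2) unfolding matching_cost_def by (auto intro: SUP_upper max.coboundedI1)
next
  case False
  have "ennreal (d_inf (the (D1 i)) (the (D2 (f i))) powr enn2real p)
      \<le> (\<Sum>\<^sub>\<infinity>i\<in>A. ennreal (d_inf (the (D1 i)) (the (D2 (f i))) powr enn2real p))"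
    using member_le_infsum_ennreal[OF assms(2)] by fast
  then show ?thesis
    using False enn2real_ge_1[OF assms(1) False] unfolding matching_cost_def
    by (auto intro!: le_enn_powr_inverse d_inf_nonneg intro: order_trans simp: add.assoc add_increasing2)
qed

lemma unmatched_left_le_matching_cost:
  assumes "1 \<le> p" "i \<in> dom D1 - A" "the (D1 i) \<in> R2_less"
  shows "ennreal (d_diag (the (D1 i))) \<le> matching_cost p D1 D2 A B f"
proof (cases "p = \<infinity>")
  case True
  have "ennreal (d_diag (the (D1 i))) \<le> (SUP i\<in>dom D1 - A. ennreal (d_diag (the (D1 i))))"
    by (rule SUP_upper[OF assms(2)])
  then show ?thesis
    using True unfolding matching_cost_def by (simp add: le_max_iff_disj)
next
  case False
  have "ennreal (d_diag (the (D1 i)) powr enn2real p)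
      \<le> (\<Sum>\<^sub>\<infinity>i\<in>dom D1 - A. ennreal (d_diag (the (D1 i)) powr enn2real p))"
    using member_le_infsum_ennreal[OF assms(2)] by fast
  then show ?thesis
    using False enn2real_ge_1[OF assms(1) False] less_imp_le[OF d_diag_pos[OF assms(3)]]
    unfolding matching_cost_def
    by (auto intro!: le_enn_powr_inverse simp: add_increasing add_increasing2)
qed

lemma unmatched_right_le_matching_cost:
  assumes "1 \<le> p" "j \<in> dom D2 - B" "the (D2 j) \<in> R2_less"
  shows "ennreal (d_diag (the (D2 j))) \<le> matching_cost p D1 D2 A B f"
proof (cases "p = \<infinity>")
  case True
  have "ennreal (d_diag (the (D2 j))) \<le> (SUP j\<in>dom D2 - B. ennreal (d_diag (the (D2 j))))"
    by (rule SUP_upper[OF assms(2)])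
  then show ?thesis
    using True unfolding matching_cost_def by (simp add: le_max_iff_disj)
next
  case False
  have "ennreal (d_diag (the (D2 j)) powr enn2real p)
      \<le> (\<Sum>\<^sub>\<infinity>j\<in>dom D2 - B. ennreal (d_diag (the (D2 j)) powr enn2real p))"
    using member_le_infsum_ennreal[OF assms(2)] by fast
  then show ?thesis
    using False enn2real_ge_1[OF assms(1) False] less_imp_le[OF d_diag_pos[OF assms(3)]]
    unfolding matching_cost_def
    by (auto intro!: le_enn_powr_inverse simp: add_increasing add_increasing2)
qed

section \<open>One-point diagrams and their distances\<close>

lemma w_tilde_le_matching_cost:
  "partial_matching D1 D2 A B f \<Longrightarrow> w_tilde p D1 D2 \<le> matching_cost p D1 D2 A B f"
  unfolding w_tilde_def by (blast intro: Inf_lower)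

lemma enn_powr_ennreal_inverse:
  assumes "1 \<le> r" "0 \<le> x"
  shows "enn_powr (ennreal (x powr r)) (1 / r) = ennreal x"
  using assms by (simp add: enn_powr_def powr_powr)

text \<open>Pairing the two points gives the upper bound. A matching that leaves \<open>a\<close>
  unmatched costs at least \<open>d_diag a\<close>, hence by \<open>le\<close> at least
  \<open>d_inf a b\<close>.\<close>

lemma w_tilde_singletons:
  assumes p: "1 \<le> p" and a: "a \<in> R2_less" and le: "d_inf a b \<le> d_diag a"
  shows "w_tilde p [m \<mapsto> a] [n \<mapsto> b] = ennreal (d_inf a b)"
proof (rule antisym)
  have "partial_matching [m \<mapsto> a] [n \<mapsto> b] {m} {n} (\<lambda>_. n)"
    by (auto simp: partial_matching_def bij_betw_def)
  \<comment> \<open>No point is left unmatched, so the other two index sets are empty: their sums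
    vanish, and their suprema are \<open>bot\<close>, which is 0 in \<open>ennreal\<close>.\<close>
  moreover have "matching_cost p [m \<mapsto> a] [n \<mapsto> b] {m} {n} (\<lambda>_. n) = ennreal (d_inf a b)"
    using enn2real_ge_1[OF p] enn_powr_ennreal_inverse[OF _ d_inf_nonneg]
    by (simp add: matching_cost_def bot_ennreal sup_max max_absorb1)
  ultimately show "w_tilde p [m \<mapsto> a] [n \<mapsto> b] \<le> ennreal (d_inf a b)"
    using w_tilde_le_matching_cost by metis
next
  have "ennreal (d_inf a b) \<le> matching_cost p [m \<mapsto> a] [n \<mapsto> b] A B f"
    if pm: "partial_matching [m \<mapsto> a] [n \<mapsto> b] A B f" for A B f
  proof (cases "m \<in> A")
    case True
    then have "f m = n"
      using pm by (auto simp: partial_matching_def bij_betw_def)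
    then show ?thesis
      using matched_le_matching_cost[OF p True, of "[m \<mapsto> a]" "[n \<mapsto> b]" f B] by simp
  next
    case False
    then show ?thesis
      using unmatched_left_le_matching_cost[OF p, of m "[m \<mapsto> a]" A "[n \<mapsto> b]" B f] a le
      by (auto intro: order_trans[OF ennreal_leI])
  qed
  then show "ennreal (d_inf a b) \<le> w_tilde p [m \<mapsto> a] [n \<mapsto> b]"
    unfolding w_tilde_def by (blast intro: Inf_greatest)
qed

lemma singleton_finite_diagram:
  assumes p: "1 \<le> p" and a: "a \<in> R2_less"
  shows "[m \<mapsto> a] \<in> finite_diagrams p"
proof -
  let ?e = "Map.empty :: nat \<rightharpoonup> real \<times> real"
  \<comment> \<open>The empty matching sends \<open>a\<close> to the diagonal, so its cost has just
    one nonzero term.\<close>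
  have "w_tilde p [m \<mapsto> a] ?e \<le> matching_cost p [m \<mapsto> a] ?e {} {} (\<lambda>_. 0)"
    by (rule w_tilde_le_matching_cost) (simp add: partial_matching_def bij_betw_def)
  also have "\<dots> < \<infinity>"
  proof (cases "p = \<infinity>")
    case True
    then show ?thesis
      by (simp add: matching_cost_def bot_ennreal sup_max max_absorb1)
  next
    case False
    then have "matching_cost p [m \<mapsto> a] ?e {} {} (\<lambda>_. 0)
        = enn_powr (ennreal (d_diag a powr enn2real p)) (1 / enn2real p)"
      by (simp add: matching_cost_def)
    then show ?thesis
      by (simp add: enn_powr_def)
  qed
  finally have "w_tilde p [m \<mapsto> a] ?e < \<infinity>" .
  moreover have "persistence_diagram [m \<mapsto> a]"
    using a by (simp add: persistence_diagram_def)
  ultimately show ?thesis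
    by (simp add: finite_diagrams_def)
qed

text \<open>Determines the class of a one-point diagram up to the index of its point, which controls
  the representative that \<open>SOME\<close> picks in \<open>wasserstein\<close>. An infimum equal
  to 0 need not be attained a priori, so the proof works with matchings of arbitrarily small
  cost.\<close>

lemma w_tilde_singleton_eq_0D:
  assumes p: "1 \<le> p" and a: "a \<in> R2_less" and E: "persistence_diagram E"
    and zero: "w_tilde p [m \<mapsto> a] E = 0"
  shows "\<exists>n. E = [n \<mapsto> a]"
proof -
  have E_R2: "the (E j) \<in> R2_less" if "j \<in> dom E" for j
    using that E by (auto simp: persistence_diagram_def intro: ranI)
  \<comment> \<open>A matching of cost below \<open>e\<close> cannot leave \<open>a\<close>
    unmatched, since \<open>e \<le> d_diag a\<close>. It pairs \<open>a\<close> with a single point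
    \<open>n\<close> of \<open>E\<close>, which may depend on \<open>e\<close>, and leaves all other
    points of \<open>E\<close> to the diagonal.\<close>
  have near: "\<exists>n\<in>dom E. d_inf a (the (E n)) < e \<and> (\<forall>j\<in>dom E - {n}. d_diag (the (E j)) < e)"
    if e: "0 < e" "e \<le> d_diag a" for e
  proof -
    have "w_tilde p [m \<mapsto> a] E < ennreal e"
      using zero e by simp
    then obtain A B f where pm: "partial_matching [m \<mapsto> a] E A B f"
      and cost: "matching_cost p [m \<mapsto> a] E A B f < ennreal e"
      unfolding w_tilde_def Inf_less_iff by blast
    have "m \<in> A"
    proof (rule ccontr)
      assume "m \<notin> A"
      then have "ennreal (d_diag a) < ennreal e"
        using unmatched_left_le_matching_cost[OF p, of m "[m \<mapsto> a]" A E B f] a cost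
        by (auto intro: order_le_less_trans)
      with e show False
        by (simp add: ennreal_less_iff)
    qed
    then have B: "B = {f m}" and "f m \<in> dom E"
      using pm by (auto simp: partial_matching_def bij_betw_def)
    moreover have "d_inf a (the (E (f m))) < e"
      using order_le_less_trans[OF matched_le_matching_cost[OF p \<open>m \<in> A\<close>] cost]
      by (simp add: ennreal_less_iff d_inf_nonneg)
    moreover have "d_diag (the (E j)) < e" if "j \<in> dom E - {f m}" for j
    proof -
      have "ennreal (d_diag (the (E j))) < ennreal e"
      proof (rule order_le_less_trans[OF unmatched_right_le_matching_cost[OF p] cost])
        show "j \<in> dom E - B"
          using that B by simp
        show "the (E j) \<in> R2_less"
          using that by (simp add: E_R2)
      qed
      then show ?thesis
        using d_diag_pos[OF E_R2, of j] that by (simp add: ennreal_less_iff)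
    qed
    ultimately show ?thesis
      by blast
  qed
  have a_pos: "0 < d_diag a"
    by (rule d_diag_pos[OF a])
  obtain n where n: "n \<in> dom E"
    using near[OF a_pos] by blast
  have dom: "j = n" if j: "j \<in> dom E" for j
  proof (rule ccontr)
    assume "j \<noteq> n"
    \<comment> \<open>At most one of \<open>j\<close> and \<open>n\<close> is the matched index
      \<open>k\<close>. The other one would be closer than \<open>e\<close> to the diagonal,
      although \<open>e\<close> is at most the distance of either point to it.\<close>
    define e where "e = min (d_diag a) (min (d_diag (the (E j))) (d_diag (the (E n))))"
    have "0 < e" "e \<le> d_diag a"
      using a_pos d_diag_pos E_R2 j n by (auto simp: e_def)
    from near[OF this] obtain k where
      k: "\<And>i. i \<in> dom E - {k} \<Longrightarrow> d_diag (the (E i)) < e" by blast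
    show False
      using k[of j] k[of n] j n \<open>j \<noteq> n\<close> unfolding e_def by fastforce
  qed
  \<comment> \<open>As \<open>n\<close> is the only index of \<open>E\<close>, it is the one
    supplied by \<open>near\<close> for every \<open>e\<close>. Taking \<open>e\<close> at most
    \<open>d_inf a (the (E n))\<close> then excludes a positive distance.\<close>
  have "d_inf a (the (E n)) = 0"
  proof (rule ccontr)
    assume "d_inf a (the (E n)) \<noteq> 0"
    then have "0 < min (d_diag a) (d_inf a (the (E n)))"
      using a_pos d_inf_nonneg[of a "the (E n)"] by simp
    from near[OF this] show False
      using dom by fastforce
  qed
  then have "a = the (E n)"
    by (rule d_inf_eq_0D)
  then have En: "E n = Some a"
    using n by auto
  have "E j = [n \<mapsto> a] j" for j
    using En dom[of j] by (cases "E j") auto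
  then have "E = [n \<mapsto> a]" ..
  then show ?thesis ..
qed

section \<open>Classes of one-point diagrams in \<open>Dgm p\<close>\<close>

definition point_class :: "ennreal \<Rightarrow> real \<times> real \<Rightarrow> (nat \<rightharpoonup> real \<times> real) set" where
  "point_class p a = dgm_rel p `` {[0 \<mapsto> a]}"

lemma point_class_in_Dgm: "1 \<le> p \<Longrightarrow> a \<in> R2_less \<Longrightarrow> point_class p a \<in> Dgm p"
  unfolding Dgm_def point_class_def by (intro quotientI singleton_finite_diagram)

text \<open>The class contains \<open>[0 \<mapsto> a]\<close>, so \<open>SOME\<close> does pick a
  member, and every member lies at distance 0 from that diagram. The index \<open>n\<close> is
  unknown but harmless, as \<open>w_tilde_singletons\<close> holds for all indices.\<close>

lemma some_in_point_class:
  assumes p: "1 \<le> p" and a: "a \<in> R2_less"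
  shows "\<exists>n. (SOME D. D \<in> point_class p a) = [n \<mapsto> a]"
proof -
  have "d_inf a a = 0"
    by (simp add: d_inf_def)
  then have "w_tilde p [0 :: nat \<mapsto> a] [0 :: nat \<mapsto> a] = 0"
    using w_tilde_singletons[OF p a, of a] d_diag_pos[OF a] by simp
  then have "[0 \<mapsto> a] \<in> point_class p a"
    using singleton_finite_diagram[OF p a] by (simp add: point_class_def dgm_rel_def)
  then have "(SOME D. D \<in> point_class p a) \<in> point_class p a"
    by (metis someI)
  then have "persistence_diagram (SOME D. D \<in> point_class p a)"
    and "w_tilde p [0 :: nat \<mapsto> a] (SOME D. D \<in> point_class p a) = 0"
    unfolding point_class_def dgm_rel_def finite_diagrams_def by blast+
  then show ?thesis
    by (rule w_tilde_singleton_eq_0D[OF p a])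
qed

lemma wasserstein_point_class:
  assumes "1 \<le> p" "a \<in> R2_less" "b \<in> R2_less" "d_inf a b \<le> d_diag a"
  shows "wasserstein p (point_class p a) (point_class p b) = d_inf a b"
proof -
  obtain m n where "(SOME D. D \<in> point_class p a) = [m \<mapsto> a]"
    "(SOME D. D \<in> point_class p b) = [n \<mapsto> b]"
    using some_in_point_class assms by metis
  then show ?thesis
    using w_tilde_singletons[of p a b m n] assms by (simp add: wasserstein_def d_inf_nonneg)
qed

section \<open>Two midpoints of the same pair of points in the plane\<close>

theorem theorem12:
  fixes p :: ennreal
  assumes "1 \<le> p"
  shows "\<not> (\<exists>\<phi> :: (nat \<rightharpoonup> real \<times> real) set \<Rightarrow> 'h :: {real_inner, complete_space}.
    isometric_embedding (Dgm p) (wasserstein p) \<phi>)"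
proof
  assume "\<exists>\<phi> :: (nat \<rightharpoonup> real \<times> real) set \<Rightarrow> 'h. isometric_embedding (Dgm p) (wasserstein p) \<phi>"
  then obtain \<phi> :: "(nat \<rightharpoonup> real \<times> real) set \<Rightarrow> 'h"
    where \<phi>: "isometric_embedding (Dgm p) (wasserstein p) \<phi>" by blast
  define \<psi> where "\<psi> a = \<phi> (point_class p a)" for a
  have dist: "norm (\<psi> a - \<psi> b) = d_inf a b"
    if "a \<in> R2_less" "b \<in> R2_less" "d_inf a b \<le> (snd a - fst a) / 2" for a b
    using \<phi> that assms wasserstein_point_class[of p a b] point_class_in_Dgm[of p]
    by (simp add: isometric_embedding_def \<psi>_def d_diag_eq)
  \<comment> \<open>The points \<open>x\<close> and \<open>y\<close> differ only horizontally, by 2,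
    so under \<open>d_inf\<close> every \<open>(1, t)\<close> with \<open>t\<close> within 1 of 10
    is a midpoint; \<open>m\<close> and \<open>m'\<close> are two of these, at distance 1. Heights
    of at least 10 keep all four points at distance at least 4 from the diagonal, more than any of
    the distances used, so \<open>dist\<close> applies.\<close>
  define x y m m' :: "real \<times> real"
    where "x = (0, 10)" and "y = (2, 10)" and "m = (1, 10)" and "m' = (1, 11)"
  note defs = x_def y_def m_def m'_def d_inf_def R2_less_def
  have xy: "norm (\<psi> x - \<psi> y) = 2"
    using dist[of x y] by (simp add: defs)
  have "norm (\<psi> x - \<psi> m) = 1" "norm (\<psi> m - \<psi> y) = 1"
    using dist[of x m] dist[of m y] by (simp_all add: defs)
  then have "\<psi> m = (1 / 2) *\<^sub>R (\<psi> x + \<psi> y)"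
    by (intro Hilbert_midpoint_unique) (simp_all add: xy)
  moreover have "norm (\<psi> x - \<psi> m') = 1" "norm (\<psi> m' - \<psi> y) = 1"
    using dist[of x m'] dist[of m' y] by (simp_all add: defs)
  then have "\<psi> m' = (1 / 2) *\<^sub>R (\<psi> x + \<psi> y)"
    by (intro Hilbert_midpoint_unique) (simp_all add: xy)
  moreover have "norm (\<psi> m - \<psi> m') = 1"
    using dist[of m m'] by (simp add: defs)
  ultimately show False
    by simp
qed

end
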